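(* Let $A$ and $B$ be finitely generated groups, set $G = A \times B$, and let $\{U_n\}_{n=1}^\infty$ be a sequence of finite index subgroups of $G$. Assume that $[A : A \cap U_n] \to \infty$ and $[B : B \cap U_n] \to \infty$ as $n \to \infty$ (where $A$ and $B$ are identified with the subgroups $A \times \{1\}$ and $\{1\} \times B$ of $G$). Then $$\lim_{n \to \infty} \frac{d(U_n) - 1}{[G : U_n]} = 0.$$
   Context: For a finitely generated group $K$, $d(K)$ denotes the least cardinality of a generating set of $K$. *)

theory Defs
  imports "HOL-Analysis.Analysis" "HOL-Algebra.Algebra"
begin

definition fin_gen :: "('a, 'b) monoid_scheme \<Rightarrow> bool" where
  "fin_gen G \<longleftrightarrow> (\<exists>S. finite S \<and> S \<subseteq> carrier G \<and> generate G S = carrier G)"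

definition min_gens :: "('a, 'b) monoid_scheme \<Rightarrow> nat" where
  "min_gens G = (LEAST k. \<exists>S. finite S \<and> S \<subseteq> carrier G \<and> card S = k \<and> generate G S = carrier G)"

text \<open>Index [G : H] as the number of right cosets (meaningful when finite).\<close>
definition grp_index :: "('a, 'b) monoid_scheme \<Rightarrow> 'a set \<Rightarrow> nat" where
  "grp_index G H = card (rcosets\<^bsub>G\<^esub> H)"

definition fin_index_subgroup :: "'a set \<Rightarrow> ('a, 'b) monoid_scheme \<Rightarrow> bool" where
  "fin_index_subgroup H G \<longleftrightarrow> subgroup H G \<and> finite (rcosets\<^bsub>G\<^esub> H)"

end

theory Submission
  imports Defs
begin

text \<open>
  Let \<open>P\<close> and \<open>Q\<close> be the projections of \<open>U\<close> to \<open>A\<close> and \<open>B\<close>, and let \<open>M = A \<inter> U\<close>, \<open>N = B \<inter> U\<close>, so that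
  \<open>P / M\<close> and \<open>Q / N\<close> are isomorphic, of order \<open>k\<close> say, and
  \<open>[G : U] = [A : P] [B : N] = [A : M] [B : Q]\<close>.
  The group \<open>U\<close> is generated by lifts of generators of \<open>P\<close>, lifts of generators of \<open>Q\<close>, and any set \<open>R\<close>
  that generates \<open>N\<close> as a normal subgroup of \<open>Q\<close>. By Schreier the first two contributions are
  \<open>O([A : P])\<close> and \<open>O([B : Q])\<close>, which are negligible compared with \<open>[G : U]\<close>.
  For \<open>R\<close>, fix a parameter \<open>T\<close>. If \<open>k \<le> T^T\<close>, then \<open>[A : P] \<ge> [A : M] / k\<close> is large and Schreier
  generators of \<open>N\<close> will do. If \<open>k > T^T\<close>, some prime power \<open>h \<ge> T\<close> divides \<open>k\<close> and can be chosen
  to be a prime or at most \<open>T^2\<close>; Sylow gives \<open>N \<le> K \<le> Q\<close> with \<open>[K : N] = h\<close>, and \<open>N\<close> is normally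
  generated in \<open>K\<close> by at most \<open>d(K) + O_T(1) \<le> d(B) [B : N] / T + O_T(1)\<close> elements.
\<close>

section \<open>Cosets, indices and Schreier generators\<close>

text \<open>Right transversals. \<open>K\<close> and \<open>H\<close> are plain subsets of one
  ambient group, so chains of subgroups need no change of record.\<close>

definition coset_reps :: "('a, 'b) monoid_scheme \<Rightarrow> 'a set \<Rightarrow> 'a set \<Rightarrow> 'a set \<Rightarrow> bool" where
  "coset_reps G K H T \<longleftrightarrow> T \<subseteq> K \<and> bij_betw (r_coset G H) T (r_coset G H ` K)"

text \<open>The value is 0 when there are infinitely many cosets, so a positive index also certifies
  finiteness.\<close>

definition rel_index :: "('a, 'b) monoid_scheme \<Rightarrow> 'a set \<Rightarrow> 'a set \<Rightarrow> nat" where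
  "rel_index G K H = card (r_coset G H ` K)"

text \<open>For a subgroup \<open>Q\<close> containing \<open>R\<close> this is the normal closure
  of \<open>R\<close> in \<open>Q\<close>.\<close>

definition conj_closure :: "('a, 'b) monoid_scheme \<Rightarrow> 'a set \<Rightarrow> 'a set \<Rightarrow> 'a set" where
  "conj_closure G Q R = generate G {q \<otimes>\<^bsub>G\<^esub> r \<otimes>\<^bsub>G\<^esub> inv\<^bsub>G\<^esub> q | q r. q \<in> Q \<and> r \<in> R}"

lemma rel_index_carrier: "rel_index G (carrier G) H = grp_index G H"
  unfolding rel_index_def grp_index_def RCOSETS_def by (simp add: UNION_singleton_eq_range)

lemma coset_reps_card: "coset_reps G K H T \<Longrightarrow> card T = rel_index G K H"
  unfolding coset_reps_def rel_index_def by (auto dest: bij_betw_same_card)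

lemma coset_reps_finite: "coset_reps G K H T \<Longrightarrow> finite T \<longleftrightarrow> finite (r_coset G H ` K)"
  unfolding coset_reps_def by (auto dest: bij_betw_finite)

context group
begin

lemma mult_inv_cancel:
  assumes "x \<in> carrier G" "y \<in> carrier G"
  shows "x \<otimes> (inv x \<otimes> y) = y" "inv x \<otimes> (x \<otimes> y) = y"
  using assms by (simp_all add: m_assoc[symmetric])

lemmas group_normalize = m_assoc inv_mult_group mult_inv_cancel

lemma r_coset_eq_iff:
  assumes "subgroup H G" "x \<in> carrier G" "y \<in> carrier G"
  shows "H #> x = H #> y \<longleftrightarrow> x \<otimes> inv y \<in> H"
  using assms subgroup.rcos_module[OF assms(1) group_axioms, of y x]
  by (metis repr_independence repr_independenceD)

lemma coset_reps_exists:
  assumes "subgroup H G" "subgroup K G" "H \<subseteq> K"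
  obtains T where "coset_reps G K H T" "\<one> \<in> T"
proof -
  \<comment> \<open>The trivial coset is forced to be represented by \<open>\<one>\<close>; the
    Schreier and multiplication-table arguments below rely on this.\<close>
  define rep where "rep C = (if C = H then \<one> else SOME x. x \<in> K \<and> H #> x = C)" for C
  have *: "rep C \<in> K \<and> H #> rep C = C" if "C \<in> r_coset G H ` K" for C
  proof (cases "C = H")
    case True
    then show ?thesis using assms by (simp add: rep_def subgroup.one_closed subgroup.subset)
  next
    case False
    from that have "\<exists>x. x \<in> K \<and> H #> x = C" by auto
    from someI_ex[OF this] False show ?thesis by (simp add: rep_def)
  qed
  have "H = H #> \<one>" using assms(1) by (simp add: subgroup.subset)
  then have "H \<in> r_coset G H ` K" using assms(2) by (metis image_eqI subgroup.one_closed)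
  then have "\<one> \<in> rep ` (r_coset G H ` K)" by (metis image_eqI rep_def)
  moreover have "coset_reps G K H (rep ` (r_coset G H ` K))"
    unfolding coset_reps_def
  proof (intro conjI bij_betw_imageI)
    show "inj_on (r_coset G H) (rep ` r_coset G H ` K)"
      using * by (intro inj_onI) (metis (no_types, lifting) imageE)
    show "r_coset G H ` rep ` r_coset G H ` K = r_coset G H ` K"
      unfolding image_image by (rule image_cong) (use * in auto)
  qed (use * in auto)
  ultimately show thesis using that by blast
qed

lemma coset_reps_cover:
  assumes "coset_reps G K H T" "subgroup H G" "K \<subseteq> carrier G" "x \<in> K"
  obtains t where "t \<in> T" "x \<otimes> inv t \<in> H"
proof -
  from assms have "H #> x \<in> r_coset G H ` T" unfolding coset_reps_def bij_betw_def by auto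
  then obtain t where "t \<in> T" "H #> x = H #> t" by auto
  then show thesis using that assms r_coset_eq_iff[of H x t] unfolding coset_reps_def by blast
qed

lemma coset_reps_unique:
  assumes "coset_reps G K H T" "subgroup H G" "K \<subseteq> carrier G" "s \<in> T" "t \<in> T" "s \<otimes> inv t \<in> H"
  shows "s = t"
proof -
  have "H #> s = H #> t" using assms r_coset_eq_iff[of H s t] unfolding coset_reps_def by blast
  then show ?thesis using assms unfolding coset_reps_def bij_betw_def inj_on_def by blast
qed

text \<open>Products \<open>t \<otimes> s\<close> of representatives \<open>t\<close> of
  \<open>H\<close> in \<open>K\<close> and \<open>s\<close> of \<open>K\<close> in \<open>L\<close>
  form a transversal of \<open>H\<close> in \<open>L\<close>; with right cosets the factor from
  \<open>K\<close> stands on the left.\<close>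

lemma rel_index_mult:
  assumes "subgroup H G" "subgroup K G" "subgroup L G" "H \<subseteq> K" "K \<subseteq> L"
  shows "rel_index G L H = rel_index G L K * rel_index G K H"
proof -
  obtain S where S: "coset_reps G L K S" using coset_reps_exists assms by blast
  obtain T where T: "coset_reps G K H T" using coset_reps_exists assms by blast
  have Lc: "L \<subseteq> carrier G" and Kc: "K \<subseteq> carrier G" and Hc: "H \<subseteq> carrier G"
    using assms by (simp_all add: subgroup.subset)
  have SL: "S \<subseteq> L" and TK: "T \<subseteq> K" using S T by (auto simp: coset_reps_def)
  have "bij_betw (\<lambda>(s,t). H #> (t \<otimes> s)) (S \<times> T) (r_coset G H ` L)"
  proof (rule bij_betw_imageI)
    show "inj_on (\<lambda>(s,t). H #> (t \<otimes> s)) (S \<times> T)"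
    proof (rule inj_onI, clarify)
      fix s t s' t' assume *: "s \<in> S" "t \<in> T" "s' \<in> S" "t' \<in> T" "H #> (t \<otimes> s) = H #> (t' \<otimes> s')"
      have c: "s \<in> carrier G" "t \<in> carrier G" "s' \<in> carrier G" "t' \<in> carrier G" "t \<in> K" "t' \<in> K"
        using * SL TK Lc Kc by auto
      have h: "t \<otimes> s \<otimes> inv (t' \<otimes> s') \<in> H" using * c r_coset_eq_iff assms(1) by auto
      \<comment> \<open>Stripping off \<open>t\<close> and \<open>t'\<close>, which lie in
        \<open>K\<close>, shows that \<open>s\<close> and \<open>s'\<close> already agree modulo
        \<open>K\<close>.\<close>
      have "s \<otimes> inv s' = inv t \<otimes> (t \<otimes> s \<otimes> inv (t' \<otimes> s')) \<otimes> t'"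
        using c by (simp add: group_normalize)
      also have "\<dots> \<in> K" using h c assms(2,4)
        by (meson subgroup.m_closed subgroup.m_inv_closed subsetD)
      finally have "s = s'" using coset_reps_unique[OF S assms(2) Lc] * by blast
      moreover have "t \<otimes> s \<otimes> inv (t' \<otimes> s) = t \<otimes> inv t'"
        using c by (simp add: group_normalize)
      ultimately show "s = s' \<and> t = t'" using coset_reps_unique[OF T assms(1) Kc] * h by metis
    qed
    show "(\<lambda>(s,t). H #> (t \<otimes> s)) ` (S \<times> T) = r_coset G H ` L"
    proof
      show "(\<lambda>(s,t). H #> (t \<otimes> s)) ` (S \<times> T) \<subseteq> r_coset G H ` L"
        using SL TK assms(3,5) by (auto intro!: imageI subgroup.m_closed)
      show "r_coset G H ` L \<subseteq> (\<lambda>(s,t). H #> (t \<otimes> s)) ` (S \<times> T)"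
      proof clarify
        fix x assume x: "x \<in> L"
        obtain s where s: "s \<in> S" "x \<otimes> inv s \<in> K" using coset_reps_cover[OF S assms(2) Lc x] by blast
        obtain t where t: "t \<in> T" "x \<otimes> inv s \<otimes> inv t \<in> H" using coset_reps_cover[OF T assms(1) Kc s(2)] by blast
        have "x \<in> carrier G" "s \<in> carrier G" "t \<in> carrier G" using x s t SL TK Lc Kc by auto
        then have "H #> x = H #> (t \<otimes> s)"
          using t r_coset_eq_iff[OF assms(1), of x "t \<otimes> s"] by (simp add: group_normalize)
        then show "H #> x \<in> (\<lambda>(s,t). H #> (t \<otimes> s)) ` (S \<times> T)" using s t by force
      qed
    qed
  qed
  then have "card (S \<times> T) = rel_index G L H" unfolding rel_index_def by (rule bij_betw_same_card)
  then show ?thesis using S T by (simp add: card_cartesian_product coset_reps_card)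
qed

text \<open>Schreier's lemma. Reading a word over \<open>S\<close> letter by letter and replacing
  each prefix by its coset representative factors the word into elements
  \<open>t \<otimes> s \<otimes> inv (rep (t \<otimes> s))\<close> and their inverses, followed by a
  last representative. There is one such element for each pair of a generator and a coset.\<close>

theorem schreier_generators:
  assumes S: "finite S" "S \<subseteq> carrier G" and H: "subgroup H G" "H \<subseteq> generate G S"
    and fin: "finite (r_coset G H ` generate G S)"
  obtains R where "finite R" "R \<subseteq> H" "generate G R = H" "card R \<le> card S * rel_index G (generate G S) H"
proof -
  let ?K = "generate G S"
  have K: "subgroup ?K G" using S generate_is_subgroup by blast
  have Kc: "?K \<subseteq> carrier G" using K subgroup.subset by blast
  obtain T where T: "coset_reps G ?K H T" "\<one> \<in> T" using coset_reps_exists[OF H(1) K H(2)] by blast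
  have TK: "T \<subseteq> ?K" using T by (simp add: coset_reps_def)
  have Tc: "T \<subseteq> carrier G" using TK Kc by blast
  have SK: "S \<subseteq> ?K" using generate.incl by fast
  have "\<exists>t. t \<in> T \<and> x \<otimes> inv t \<in> H" if "x \<in> ?K" for x
    by (rule coset_reps_cover[OF T(1) H(1) Kc that]) auto
  then have "\<forall>x\<in>?K. \<exists>t. t \<in> T \<and> x \<otimes> inv t \<in> H" by blast
  from bchoice[OF this] obtain rep where rep: "\<And>x. x \<in> ?K \<Longrightarrow> rep x \<in> T \<and> x \<otimes> inv (rep x) \<in> H" by blast
  define R where "R = (\<lambda>(s,t). t \<otimes> s \<otimes> inv (rep (t \<otimes> s))) ` (S \<times> T)"
  have finT: "finite T" using T fin coset_reps_finite by blast
  have RH: "R \<subseteq> H" unfolding R_def using rep SK TK by (auto intro!: generate.eng)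
  have Rc: "R \<subseteq> carrier G" using RH H subgroup.subset by blast
  have sub: "subgroup (generate G R) G" using Rc generate_is_subgroup by blast
  have gRH: "generate G R \<subseteq> H" using RH H generate_subgroup_incl by blast
  \<comment> \<open>Quantifying over all starting representatives \<open>t\<close> makes the
    invariant compose along products: where the first factor ends, the second one starts.\<close>
  have step: "\<forall>t\<in>T. \<exists>t'\<in>T. t \<otimes> x \<otimes> inv t' \<in> generate G R" if "x \<in> ?K" for x
    using that
  proof (induction x rule: generate.induct)
    case one
    show ?case using Tc by (auto intro!: bexI generate.one simp: subset_iff)
  next
    case (incl s)
    have "rep (t \<otimes> s) \<in> T \<and> t \<otimes> s \<otimes> inv rep (t \<otimes> s) \<in> R" if "t \<in> T" for t
      using incl that rep[of "t \<otimes> s"] SK TK by (auto simp: R_def intro!: generate.eng)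
    then show ?case by (meson generate.incl)
  next
    case (inv s)
    show ?case
    proof
      fix t assume t: "t \<in> T"
      define u where "u = rep (t \<otimes> inv s)"
      have cs: "s \<in> carrier G" "t \<in> carrier G" using inv t S Tc by auto
      have u: "u \<in> T" "t \<otimes> inv s \<otimes> inv u \<in> H"
        using rep[of "t \<otimes> inv s"] t inv TK generate.inv[of s S G] generate.eng[of t G S "inv s"] by (auto simp: u_def)
      have uc: "u \<in> carrier G" using u Tc by auto
      \<comment> \<open>Reading \<open>s\<close> from \<open>u\<close> leads back to
        \<open>t\<close>: uniqueness of representatives gives \<open>v = t\<close>, so an inverse
        letter contributes the inverse of a Schreier generator.\<close>
      define v where "v = rep (u \<otimes> s)"
      have v: "v \<in> T" "u \<otimes> s \<otimes> inv v \<in> H"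
        using rep[of "u \<otimes> s"] u inv TK SK generate.eng[of u G S s] by (auto simp: v_def)
      have vc: "v \<in> carrier G" using v Tc by auto
      have "(t \<otimes> inv s \<otimes> inv u) \<otimes> (u \<otimes> s \<otimes> inv v) = t \<otimes> inv v"
        using cs uc vc by (simp add: group_normalize)
      then have "t \<otimes> inv v \<in> H" using u v H(1) by (metis subgroup.m_closed)
      then have "t = v" using coset_reps_unique[OF T(1) H(1) Kc] t v by blast
      then have "u \<otimes> s \<otimes> inv t \<in> R" using u inv by (auto simp: R_def v_def intro!: rev_image_eqI[of "(s,u)"])
      then have "inv (u \<otimes> s \<otimes> inv t) \<in> generate G R" by (rule generate.inv)
      moreover have "inv (u \<otimes> s \<otimes> inv t) = t \<otimes> inv s \<otimes> inv u"
        using cs uc by (simp add: group_normalize)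
      ultimately show "\<exists>t'\<in>T. t \<otimes> inv s \<otimes> inv t' \<in> generate G R" using u by auto
    qed
  next
    case (eng x y)
    show ?case
    proof
      fix t assume t: "t \<in> T"
      obtain u where u: "u \<in> T" "t \<otimes> x \<otimes> inv u \<in> generate G R" using eng t by blast
      obtain v where v: "v \<in> T" "u \<otimes> y \<otimes> inv v \<in> generate G R" using eng u by blast
      have c: "t \<in> carrier G" "u \<in> carrier G" "v \<in> carrier G" "x \<in> carrier G" "y \<in> carrier G"
        using t u v eng Tc Kc by auto
      have "(t \<otimes> x \<otimes> inv u) \<otimes> (u \<otimes> y \<otimes> inv v) = t \<otimes> (x \<otimes> y) \<otimes> inv v"
        using c by (simp add: group_normalize)
      then show "\<exists>t'\<in>T. t \<otimes> (x \<otimes> y) \<otimes> inv t' \<in> generate G R"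
        using u v generate.eng by metis
    qed
  qed
  have "H \<subseteq> generate G R"
  proof
    fix x assume x: "x \<in> H"
    then have xc: "x \<in> carrier G" using H subgroup.subset by blast
    \<comment> \<open>Starting from \<open>\<one>\<close>, an element of \<open>H\<close> must end
      in the trivial coset, whose representative is \<open>\<one>\<close>, so no remainder is
      left.\<close>
    obtain t where t: "t \<in> T" "\<one> \<otimes> x \<otimes> inv t \<in> generate G R" using step[of x] x H T by blast
    have tc: "t \<in> carrier G" using t Tc by blast
    have "x \<otimes> inv t \<in> H" using t xc gRH by auto
    then have "inv x \<otimes> (x \<otimes> inv t) \<in> H" using x H(1) by (simp add: subgroup.m_closed subgroup.m_inv_closed)
    then have "\<one> \<otimes> inv t \<in> H" using xc tc by (simp add: m_assoc[symmetric])
    then have "\<one> = t" using coset_reps_unique[OF T(1) H(1) Kc] t T by blast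
    then show "x \<in> generate G R" using t xc by auto
  qed
  moreover have "card R \<le> card S * rel_index G ?K H"
    unfolding R_def using card_image_le[of "S \<times> T"] S finT coset_reps_card[OF T(1)]
    by (simp add: card_cartesian_product)
  moreover have "finite R" using S finT by (simp add: R_def)
  ultimately show thesis using that RH gRH by blast
qed

end

section \<open>Generation as a normal subgroup\<close>

context group
begin

lemma conj_closure_subgroup:
  assumes "Q \<subseteq> carrier G" "R \<subseteq> carrier G"
  shows "subgroup (conj_closure G Q R) G"
  unfolding conj_closure_def using assms by (intro generate_is_subgroup) auto

lemma conj_closure_contains:
  assumes "subgroup Q G" "R \<subseteq> carrier G"
  shows "R \<subseteq> conj_closure G Q R"
proof
  fix r assume r: "r \<in> R"
  then have "r = \<one> \<otimes> r \<otimes> inv \<one>" using assms by auto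
  with r show "r \<in> conj_closure G Q R"
    unfolding conj_closure_def by (intro generate.incl) (use subgroup.one_closed[OF assms(1)] in blast)
qed

text \<open>Conjugation by \<open>q\<close> turns the conjugate of \<open>r\<close> by
  \<open>p\<close> into its conjugate by \<open>q \<otimes> p\<close>, so it preserves the
  generating set; this passes to products and inverses.\<close>

lemma conj_closure_conj:
  assumes Q: "subgroup Q G" and R: "R \<subseteq> carrier G" and q: "q \<in> Q" and x: "x \<in> conj_closure G Q R"
  shows "q \<otimes> x \<otimes> inv q \<in> conj_closure G Q R"
proof -
  let ?X = "{q \<otimes> r \<otimes> inv q | q r. q \<in> Q \<and> r \<in> R}"
  have Qc: "Q \<subseteq> carrier G" using Q by (rule subgroup.subset)
  have qc: "q \<in> carrier G" using q Qc by blast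
  have Xc: "?X \<subseteq> carrier G" using Qc R by auto
  have X: "q \<otimes> x \<otimes> inv q \<in> ?X" if "x \<in> ?X" for x
  proof -
    from that obtain p r where p: "p \<in> Q" "r \<in> R" "x = p \<otimes> r \<otimes> inv p" by blast
    have "q \<otimes> x \<otimes> inv q = (q \<otimes> p) \<otimes> r \<otimes> inv (q \<otimes> p)"
      using p Qc qc R by (simp add: group_normalize subset_iff)
    then show ?thesis using p q Q by (blast intro: subgroup.m_closed)
  qed
  from x show ?thesis unfolding conj_closure_def
  proof (induction x rule: generate.induct)
    case one
    then show ?case using qc by (simp add: generate.one)
  next
    case (incl h)
    then show ?case using X by (intro generate.incl)
  next
    case (inv h)
    have hc: "h \<in> carrier G" using inv Xc by blast
    have "inv (q \<otimes> h \<otimes> inv q) = q \<otimes> inv h \<otimes> inv q" using hc qc by (simp add: group_normalize)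
    then show ?case using generate.inv[OF X[OF inv], of G] by simp
  next
    case (eng h k)
    have c: "h \<in> carrier G" "k \<in> carrier G" using eng generate_incl[OF Xc] by blast+
    have "q \<otimes> (h \<otimes> k) \<otimes> inv q = (q \<otimes> h \<otimes> inv q) \<otimes> (q \<otimes> k \<otimes> inv q)"
      using c qc by (simp add: group_normalize)
    then show ?case using generate.eng[OF eng.IH] by simp
  qed
qed

lemma conj_closure_least:
  assumes "subgroup N G" "R \<subseteq> N" "\<And>q n. q \<in> Q \<Longrightarrow> n \<in> N \<Longrightarrow> q \<otimes> n \<otimes> inv q \<in> N"
  shows "conj_closure G Q R \<subseteq> N"
  unfolding conj_closure_def using assms by (intro generate_subgroup_incl) auto

text \<open>Von Dyck's argument: if modulo \<open>M\<close> every product of elements of \<open>T\<close> reduces to an element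
  of \<open>T\<close>, then \<open>T M\<close> is already the whole group \<open>K\<close>, which leaves no room for \<open>N\<close> beyond \<open>M\<close>.\<close>

lemma subset_of_relations:
  assumes K: "S \<subseteq> carrier G" "K = generate G S" and N: "N \<subseteq> K"
    and M: "subgroup M G" "M \<subseteq> N" "subgroup N G"
    and conj: "\<And>q m. q \<in> K \<Longrightarrow> m \<in> M \<Longrightarrow> q \<otimes> m \<otimes> inv q \<in> M"
    and T: "T \<subseteq> K" "\<one> \<in> T"
    and mult: "\<And>s t. s \<in> T \<Longrightarrow> t \<in> T \<Longrightarrow> \<exists>u\<in>T. inv u \<otimes> (s \<otimes> t) \<in> M"
    and inver: "\<And>t. t \<in> T \<Longrightarrow> \<exists>u\<in>T. inv u \<otimes> inv t \<in> M"
    and gens: "\<And>s. s \<in> S \<Longrightarrow> \<exists>u\<in>T. inv u \<otimes> s \<in> M"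
    and TN: "T \<inter> N \<subseteq> M"
  shows "N \<subseteq> M"
proof
  have Ks: "subgroup K G" using K generate_is_subgroup by blast
  have Kc: "K \<subseteq> carrier G" using Ks by (rule subgroup.subset)
  have Tc: "T \<subseteq> carrier G" using T Kc by blast
  have Mc: "M \<subseteq> carrier G" using M(1) by (rule subgroup.subset)
  \<comment> \<open>If \<open>x\<close> is congruent to \<open>t\<close> modulo \<open>M\<close>,
    then \<open>inv x\<close> is congruent to \<open>inv t\<close> because \<open>K\<close>
    normalises \<open>M\<close>; the representative of \<open>inv t\<close> then serves for
    \<open>inv x\<close>.\<close>
  have inv_red: "\<exists>u\<in>T. inv u \<otimes> inv x \<in> M" if x: "x \<in> K" "t \<in> T" "inv t \<otimes> x \<in> M" for x t
  proof -
    obtain u where u: "u \<in> T" "inv u \<otimes> inv t \<in> M" using inver x by blast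
    have c: "x \<in> carrier G" "t \<in> carrier G" "u \<in> carrier G" "t \<in> K" using x u Kc Tc T by auto
    have "t \<otimes> inv (inv t \<otimes> x) \<otimes> inv t \<in> M" using x c conj M(1) by (blast intro: subgroup.m_inv_closed)
    then have "inv x \<otimes> t \<in> M \<and> t \<otimes> inv x \<in> M" using c x M(1) subgroup.m_inv_closed[OF M(1) x(3)]
      by (simp add: group_normalize)
    then have "(inv u \<otimes> inv t) \<otimes> (t \<otimes> inv x) \<in> M" using u M(1) by (blast intro: subgroup.m_closed)
    then show ?thesis using u c by (auto simp: group_normalize)
  qed
  have red: "\<exists>t\<in>T. inv t \<otimes> x \<in> M" if "x \<in> K" for x
    using that unfolding K(2)
  proof (induction x rule: generate.induct)
    case one
    show ?case using T(2) subgroup.one_closed[OF M(1)] by (intro bexI[of _ \<one>]) auto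
  next
    case (incl h)
    then show ?case using gens by blast
  next
    case (inv h)
    then show ?case using gens inv_red[of h] generate.incl[of h S G] K(2) by blast
  next
    case (eng x y)
    obtain s where s: "s \<in> T" "inv s \<otimes> x \<in> M" using eng by blast
    obtain t where t: "t \<in> T" "inv t \<otimes> y \<in> M" using eng by blast
    obtain u where u: "u \<in> T" "inv u \<otimes> (s \<otimes> t) \<in> M" using mult s t by blast
    have c: "s \<in> carrier G" "t \<in> carrier G" "u \<in> carrier G" "x \<in> carrier G" "y \<in> carrier G"
      using s t u eng Tc Kc K(2) by auto
    have "inv t \<in> K" using t T Ks by (blast intro: subgroup.m_inv_closed)
    \<comment> \<open>With \<open>x = s m\<close> and \<open>y = t n\<close> for \<open>m\<close>,
      \<open>n\<close> in \<open>M\<close>, the product is \<open>s t (inv t m t) n\<close>: the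
      error of \<open>x\<close> has to be conjugated past \<open>t\<close>.\<close>
    then have "inv t \<otimes> (inv s \<otimes> x) \<otimes> inv (inv t) \<in> M" using conj s by blast
    then have "(inv u \<otimes> (s \<otimes> t)) \<otimes> (inv t \<otimes> (inv s \<otimes> x) \<otimes> inv (inv t)) \<otimes> (inv t \<otimes> y) \<in> M"
      using u t M(1) by (blast intro: subgroup.m_closed)
    then have "inv u \<otimes> (x \<otimes> y) \<in> M" using c by (simp add: group_normalize)
    then show ?case using u by blast
  qed
  fix x assume x: "x \<in> N"
  then obtain t where t: "t \<in> T" "inv t \<otimes> x \<in> M" using red N by blast
  have c: "x \<in> carrier G" "t \<in> carrier G" using x t N Kc Tc by auto
  \<comment> \<open>Both \<open>x\<close> and its error lie in \<open>N\<close>, so the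
    representative \<open>t\<close> lies in \<open>T \<inter> N\<close> and hence in
    \<open>M\<close>.\<close>
  have "x \<otimes> inv (inv t \<otimes> x) \<in> N" using x t M by (blast intro: subgroup.m_closed subgroup.m_inv_closed)
  then have "t \<in> N" using c by (simp add: group_normalize)
  then have "t \<in> M" using TN t by blast
  then have "t \<otimes> (inv t \<otimes> x) \<in> M" using t M(1) by (blast intro: subgroup.m_closed)
  then show "x \<in> M" using c by (simp add: group_normalize)
qed

text \<open>The preceding argument with \<open>M\<close> taken to be the normal closure of
  \<open>R\<close> in \<open>Q\<close>. It is enough that \<open>R\<close> contains the nontrivial
  corrections that bring products and inverses of elements of \<open>T\<close>, and the generators
  of \<open>K\<close>, back into \<open>T\<close>.\<close>

lemma conj_closure_eq_of_relations:
  assumes Q: "subgroup Q G" and S: "S \<subseteq> carrier G" "K = generate G S" "K \<subseteq> Q"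
    and N: "subgroup N G" "N \<subseteq> K"
    and norm: "\<And>q n. q \<in> Q \<Longrightarrow> n \<in> N \<Longrightarrow> q \<otimes> n \<otimes> inv q \<in> N"
    and R: "R \<subseteq> N" and T: "T \<subseteq> K" "\<one> \<in> T"
    and mult: "\<And>s t. s \<in> T \<Longrightarrow> t \<in> T \<Longrightarrow> \<exists>u\<in>T. inv u \<otimes> (s \<otimes> t) \<in> insert \<one> R"
    and inver: "\<And>t. t \<in> T \<Longrightarrow> \<exists>u\<in>T. inv u \<otimes> inv t \<in> insert \<one> R"
    and gens: "\<And>s. s \<in> S \<Longrightarrow> \<exists>u\<in>T. inv u \<otimes> s \<in> insert \<one> R"
    and TN: "T \<inter> N \<subseteq> conj_closure G Q R"
  shows "conj_closure G Q R = N"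
proof
  have Rc: "R \<subseteq> carrier G" using R N(1) subgroup.subset by blast
  have Qc: "Q \<subseteq> carrier G" using Q by (rule subgroup.subset)
  show 1: "conj_closure G Q R \<subseteq> N" using conj_closure_least[OF N(1) R norm] .
  have sub: "subgroup (conj_closure G Q R) G" by (rule conj_closure_subgroup[OF Qc Rc])
  have "insert \<one> R \<subseteq> conj_closure G Q R"
    using conj_closure_contains[OF Q Rc] subgroup.one_closed[OF sub] by blast
  then show "N \<subseteq> conj_closure G Q R"
    using mult inver gens S(3)
    by (intro subset_of_relations[OF S(1,2) N(2) sub 1 N(1) _ T _ _ _ TN] conj_closure_conj[OF Q Rc]) blast+
qed

text \<open>The multiplication table of \<open>K / N\<close> serves as a presentation: one
  correction per generator of \<open>K\<close>, at most \<open>h^2\<close> for products and at most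
  \<open>h\<close> for inverses. A transversal through \<open>\<one>\<close> meets \<open>N\<close>
  only in \<open>\<one>\<close>.\<close>

lemma normal_generators_finite_quotient:
  assumes Q: "subgroup Q G" and S: "finite S" "S \<subseteq> carrier G" "K = generate G S" "K \<subseteq> Q"
    and N: "subgroup N G" "N \<subseteq> K"
    and norm: "\<And>q n. q \<in> Q \<Longrightarrow> n \<in> N \<Longrightarrow> q \<otimes> n \<otimes> inv q \<in> N"
    and fin: "finite (r_coset G N ` K)" and h: "rel_index G K N \<le> h"
  obtains R where "finite R" "R \<subseteq> N" "card R \<le> card S + h^2 + h" "conj_closure G Q R = N"
proof -
  have Ks: "subgroup K G" using S generate_is_subgroup by blast
  have Kc: "K \<subseteq> carrier G" using Ks by (rule subgroup.subset)
  obtain T where T: "coset_reps G K N T" "\<one> \<in> T" using coset_reps_exists[OF N(1) Ks N(2)] by blast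
  have TK: "T \<subseteq> K" using T by (simp add: coset_reps_def)
  have finT: "finite T" using T fin coset_reps_finite by blast
  have cT: "card T \<le> h" using coset_reps_card[OF T(1)] h by simp
  \<comment> \<open>Transversals are taken for right cosets, while the corrections stand to the
    right of the representative; normality of \<open>N\<close> turns
    \<open>x \<otimes> inv t\<close> into \<open>inv t \<otimes> x\<close>.\<close>
  have "\<exists>t. t \<in> T \<and> inv t \<otimes> x \<in> N" if x: "x \<in> K" for x
  proof -
    obtain t where t: "t \<in> T" "x \<otimes> inv t \<in> N" by (rule coset_reps_cover[OF T(1) N(1) Kc x])
    have c: "t \<in> carrier G" "x \<in> carrier G" "inv t \<in> Q"
      using t x TK Kc S(4) Q by (auto intro: subgroup.m_inv_closed)
    have "inv t \<otimes> (x \<otimes> inv t) \<otimes> inv (inv t) \<in> N" using norm t c by blast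
    then show ?thesis using t c by (auto simp: group_normalize)
  qed
  then have "\<forall>x\<in>K. \<exists>t. t \<in> T \<and> inv t \<otimes> x \<in> N" by blast
  from bchoice[OF this] obtain rep where rep: "\<And>x. x \<in> K \<Longrightarrow> rep x \<in> T \<and> inv (rep x) \<otimes> x \<in> N" by blast
  define Y where "Y = S \<union> (\<lambda>(s,t). s \<otimes> t) ` (T \<times> T) \<union> m_inv G ` T"
  define R where "R = (\<lambda>x. inv (rep x) \<otimes> x) ` Y"
  have finX: "finite Y" using S finT by (simp add: Y_def)
  have XK: "Y \<subseteq> K"
    using TK Ks S(3) generate.incl[of _ S G] by (auto simp: Y_def intro: subgroup.m_closed subgroup.m_inv_closed)
  have RN: "R \<subseteq> N" using rep XK by (auto simp: R_def)
  have repX: "\<exists>u\<in>T. inv u \<otimes> x \<in> insert \<one> R" if "x \<in> Y" for x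
    using that rep[of x] XK by (auto simp: R_def)
  have "card Y \<le> card (S \<union> (\<lambda>(s,t). s \<otimes> t) ` (T \<times> T)) + card (m_inv G ` T)"
    unfolding Y_def by (rule card_Un_le)
  also have "\<dots> \<le> card S + card ((\<lambda>(s,t). s \<otimes> t) ` (T \<times> T)) + card (m_inv G ` T)"
    by (simp add: card_Un_le)
  also have "\<dots> \<le> card S + card (T \<times> T) + card T"
    using finT by (intro add_mono card_image_le) auto
  also have "\<dots> \<le> card S + h^2 + h"
    using cT by (auto simp: card_cartesian_product power2_eq_square intro!: add_mono mult_mono)
  finally have cX: "card Y \<le> card S + h^2 + h" .
  have "card R \<le> card Y" unfolding R_def using finX by (rule card_image_le)
  moreover have "conj_closure G Q R = N"
  proof (rule conj_closure_eq_of_relations[OF Q S(2-4) N norm RN TK T(2)])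
    have "t = \<one>" if "t \<in> T" "t \<in> N" for t
      using coset_reps_unique[OF T(1) N(1) Kc that(1) T(2)] that TK Kc by auto
    then show "T \<inter> N \<subseteq> conj_closure G Q R"
      using subgroup.one_closed[OF conj_closure_subgroup, of Q R] Q RN N(1) by (auto dest!: subgroup.subset)
  qed (assumption | rule repX, force simp: Y_def)+
  moreover have "finite R" using finX by (simp add: R_def)
  ultimately show thesis using that RN cX le_trans by blast
qed

text \<open>The powers of \<open>c\<close> are closed under products and inverses, so these cost no
  relators. What remains is one correction per generator and the single relator
  \<open>c [^] p\<close>, so the count does not grow with the order of the quotient.\<close>

lemma normal_generators_cyclic_quotient:
  assumes Q: "subgroup Q G" and S: "finite S" "S \<subseteq> carrier G" "K = generate G S" "K \<subseteq> Q"
    and N: "subgroup N G" "N \<subseteq> K"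
    and norm: "\<And>q n. q \<in> Q \<Longrightarrow> n \<in> N \<Longrightarrow> q \<otimes> n \<otimes> inv q \<in> N"
    and c: "c \<in> K" and cyc: "\<And>x. x \<in> K \<Longrightarrow> \<exists>i::int. x \<otimes> inv (c [^] i) \<in> N"
    and p: "\<And>i::int. c [^] i \<in> N \<longleftrightarrow> p dvd i"
  obtains R where "finite R" "R \<subseteq> N" "card R \<le> card S + 1" "conj_closure G Q R = N"
proof -
  have Ks: "subgroup K G" using S generate_is_subgroup by blast
  have Kc: "K \<subseteq> carrier G" using Ks by (rule subgroup.subset)
  have cc: "c \<in> carrier G" using c Kc by blast
  \<comment> \<open>All powers are taken instead of a transversal; those that fall into
    \<open>N\<close> are powers of \<open>c [^] p\<close>.\<close>
  define T where "T = range (\<lambda>i::int. c [^] i)"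
  have TK: "T \<subseteq> K" unfolding T_def using c Ks by (auto intro: subgroup_int_pow_closed)
  have T1: "\<one> \<in> T" unfolding T_def by (metis int_pow_0 rangeI)
  have "\<exists>t. t \<in> T \<and> inv t \<otimes> x \<in> N" if x: "x \<in> K" for x
  proof -
    obtain t where t: "t \<in> T" "x \<otimes> inv t \<in> N" using cyc[OF x] by (auto simp: T_def)
    have c: "t \<in> carrier G" "x \<in> carrier G" "inv t \<in> Q"
      using t x TK Kc S(4) Q by (auto intro: subgroup.m_inv_closed)
    have "inv t \<otimes> (x \<otimes> inv t) \<otimes> inv (inv t) \<in> N" using norm t c by blast
    then show ?thesis using t c by (auto simp: group_normalize)
  qed
  then have "\<forall>x\<in>K. \<exists>t. t \<in> T \<and> inv t \<otimes> x \<in> N" by blast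
  from bchoice[OF this] obtain rep where rep: "\<And>x. x \<in> K \<Longrightarrow> rep x \<in> T \<and> inv (rep x) \<otimes> x \<in> N" by blast
  define R where "R = insert (c [^] p) ((\<lambda>x. inv (rep x) \<otimes> x) ` S)"
  have SK: "S \<subseteq> K" using S(3) generate.incl by fast
  have RN: "R \<subseteq> N" using rep SK p[of p] by (auto simp: R_def)
  have Rc: "R \<subseteq> carrier G" using RN N(1) subgroup.subset by blast
  have "card R \<le> card S + 1"
    unfolding R_def using card_image_le[OF S(1), of "\<lambda>x. inv (rep x) \<otimes> x"] S(1)
    by (simp add: card_insert_if)
  moreover have "conj_closure G Q R = N"
  proof (rule conj_closure_eq_of_relations[OF Q S(2-4) N norm RN TK T1])
    fix s t assume "s \<in> T" "t \<in> T"
    then obtain i j :: int where "s = c [^] i" "t = c [^] j" by (auto simp: T_def)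
    then have "inv (c [^] (i+j)) \<otimes> (s \<otimes> t) = \<one>" using cc by (simp add: int_pow_mult)
    then show "\<exists>u\<in>T. inv u \<otimes> (s \<otimes> t) \<in> insert \<one> R" by (auto simp: T_def)
  next
    fix t assume "t \<in> T"
    then obtain i :: int where "t = c [^] i" by (auto simp: T_def)
    then have "inv (c [^] (-i)) \<otimes> inv t = \<one>" using cc by (simp add: int_pow_neg)
    then show "\<exists>u\<in>T. inv u \<otimes> inv t \<in> insert \<one> R" by (auto simp: T_def)
  next
    fix s assume "s \<in> S"
    then show "\<exists>u\<in>T. inv u \<otimes> s \<in> insert \<one> R" using rep SK by (auto simp: R_def)
  next
    have sub: "subgroup (conj_closure G Q R) G" using Q Rc conj_closure_subgroup subgroup.subset by metis
    have cp: "c [^] p \<in> conj_closure G Q R" using conj_closure_contains[OF Q Rc] by (auto simp: R_def)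
    show "T \<inter> N \<subseteq> conj_closure G Q R"
    proof
      fix t assume "t \<in> T \<inter> N"
      then obtain i :: int where i: "t = c [^] i" "c [^] i \<in> N" by (auto simp: T_def)
      then obtain j where "i = p * j" using p by (auto simp: dvd_def)
      then have "t = (c [^] p) [^] j" using i cc by (simp add: int_pow_pow)
      then show "t \<in> conj_closure G Q R" using subgroup_int_pow_closed[OF sub cp] by simp
    qed
  qed
  moreover have "finite R" using S by (simp add: R_def)
  ultimately show thesis using that RN by blast
qed

end

section \<open>Normal generators over a large quotient\<close>

text \<open>If every prime power dividing \<open>k\<close> were below \<open>T\<close>, there would
  be at most \<open>T\<close> prime factors, each contributing less than \<open>T\<close>, so
  \<open>k \<le> T ^ T\<close>. A large prime power is then trimmed: either the prime itself reaches
  \<open>T\<close>, or the least sufficient power overshoots by a factor below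
  \<open>T\<close>.\<close>

lemma large_prime_power_divisor:
  fixes k T :: nat
  assumes T: "T \<ge> 1" and k: "k > T ^ T"
  obtains p i where "Factorial_Ring.prime p" "p ^ i dvd k" "p ^ i \<ge> T" "p ^ i \<le> T\<^sup>2 \<or> i = 1"
proof -
  have "\<exists>p i. Factorial_Ring.prime p \<and> p ^ i dvd k \<and> p ^ i \<ge> T"
  proof (rule ccontr)
    assume "\<not> ?thesis"
    then have less: "p ^ i < T" if "Factorial_Ring.prime p" "p ^ i dvd k" for p i
      using that by (meson not_le)
    have "prime_factors k \<subseteq> {..<T}"
    proof
      fix p assume "p \<in> prime_factors k"
      then show "p \<in> {..<T}" using less[of p 1] by (auto simp: in_prime_factors_iff)
    qed
    then have c: "card (prime_factors k) \<le> T" by (metis card_lessThan card_mono finite_lessThan)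
    have "k = (\<Prod>p\<in>prime_factors k. p ^ multiplicity p k)"
      using k by (intro prime_factorization_nat) auto
    also have "\<dots> \<le> (\<Prod>p\<in>prime_factors k. T)"
      using less by (intro prod_mono) (auto simp: in_prime_factors_iff multiplicity_dvd intro!: less_imp_le)
    also have "\<dots> \<le> T ^ T" using c T by (simp add: power_increasing)
    finally show False using k by simp
  qed
  then obtain p i where p: "Factorial_Ring.prime p" "p ^ i dvd k" "p ^ i \<ge> T" by blast
  define j where "j = (LEAST j. p ^ j \<ge> T)"
  have j: "p ^ j \<ge> T" "j \<le> i" unfolding j_def using p(3) by (auto intro: LeastI Least_le)
  have jk: "p ^ j dvd k" using p(2) j(2) by (meson dvd_trans le_imp_power_dvd)
  show thesis
  proof (cases j)
    \<comment> \<open>This forces \<open>T = 1\<close>, where the prime power 1 qualifies.\<close>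
    case 0
    then show thesis using that[of p 0] p j T by auto
  next
    case (Suc m)
    then have m: "p ^ m < T" using not_less_Least[of m "\<lambda>j. p ^ j \<ge> T"] by (auto simp: j_def)
    show thesis
    proof (cases "p \<ge> T")
      case True
      have "p ^ 1 dvd k" using jk Suc by (auto dest: dvd_mult_left)
      then show thesis using that[of p 1] p True by auto
    next
      case False
      then have "p ^ j \<le> T\<^sup>2" using Suc m by (auto simp: power2_eq_square intro!: mult_mono)
      then show thesis using that p jk j by blast
    qed
  qed
qed

text \<open>By Lagrange inside \<open>A\<close>, a nontrivial element has order dividing
  \<open>p\<close> and different from 1, so its powers exhaust \<open>A\<close>.\<close>

lemma (in group) subgroup_prime_order_cyclic:
  assumes A: "subgroup A G" and card: "card A = p" and p: "Factorial_Ring.prime p"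
  obtains x where "x \<in> A" "ord x = p" "\<And>y. y \<in> A \<Longrightarrow> \<exists>i::int. y = x [^] i"
proof -
  have fin: "finite A" using card p by (metis card.infinite not_prime_0)
  have "A \<noteq> {\<one>}" using card p by auto
  then obtain x where x: "x \<in> A" "x \<noteq> \<one>" using subgroup.one_closed[OF A] by blast
  have xc: "x \<in> carrier G" using x A subgroup.subset by blast
  interpret A: group "G\<lparr>carrier := A\<rparr>" using A by (rule subgroup_imp_group)
  have sub: "generate G {x} \<subseteq> A" using x A by (intro generate_subgroup_incl) auto
  have "subgroup (generate G {x}) (G\<lparr>carrier := A\<rparr>)"
    using sub xc A by (intro subgroup_incl generate_is_subgroup) auto
  from A.lagrange[OF this] have "card A = card (rcosets\<^bsub>G\<lparr>carrier := A\<rparr>\<^esub> generate G {x}) * card (generate G {x})"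
    by (simp add: order_def)
  then have "card (generate G {x}) dvd p" unfolding card by (metis dvd_triv_right)
  then have "ord x dvd p" using generate_pow_card[OF xc] by simp
  moreover have "ord x \<noteq> 1" using x xc ord_eq_1 by blast
  ultimately have ord: "ord x = p" using p by (metis prime_nat_iff)
  then have "generate G {x} = A" using sub fin card generate_pow_card[OF xc] by (intro card_subset_eq) auto
  then show thesis using that[OF x(1) ord] generate_pow[OF xc] by blast
qed

context group
begin

text \<open>Sylow's theorem in \<open>Q / N\<close>, pulled back to \<open>Q\<close>. For
  \<open>i = 1\<close> the subgroup found is cyclic and \<open>c\<close> lifts a generator; the two
  conditions on \<open>c\<close> say that its coset generates \<open>K / N\<close> and has order
  \<open>p\<close>.\<close>

lemma prime_power_overgroup:
  assumes Q: "subgroup Q G" and N: "subgroup N G" "N \<subseteq> Q"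
    and norm: "\<And>q n. q \<in> Q \<Longrightarrow> n \<in> N \<Longrightarrow> q \<otimes> n \<otimes> inv q \<in> N"
    and fin: "finite (r_coset G N ` Q)" and p: "Factorial_Ring.prime p" and dvd: "p ^ i dvd rel_index G Q N"
  obtains K where "subgroup K G" "N \<subseteq> K" "K \<subseteq> Q" "rel_index G K N = p ^ i"
    "i = 1 \<Longrightarrow> \<exists>c\<in>K. (\<forall>x\<in>K. \<exists>j::int. x \<otimes> inv (c [^] j) \<in> N) \<and> (\<forall>j::int. c [^] j \<in> N \<longleftrightarrow> int p dvd j)"
proof -
  let ?Q = "G\<lparr>carrier := Q\<rparr>"
  have Qc: "Q \<subseteq> carrier G" using Q by (rule subgroup.subset)
  interpret Q: group ?Q using Q by (rule subgroup_imp_group)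
  have "N \<lhd> ?Q"
    unfolding Q.normal_inv_iff using subgroup_incl[OF N(1) Q N(2)] norm
    by (auto simp: m_inv_consistent[OF Q])
  then interpret NQ: normal N ?Q .
  interpret F: group "?Q Mod N" by (rule NQ.factorgroup_is_group)
  have coset: "r_coset ?Q N x = N #> x" for x by (simp add: r_coset_def)
  have carF: "carrier (?Q Mod N) = r_coset G N ` Q" by (simp add: carrier_FactGroup coset)
  \<comment> \<open>Sylow's theorem is applied to an arbitrary prime power dividing the order, not
    only to the full \<open>p\<close>-part.\<close>
  obtain m where "order (?Q Mod N) = p ^ i * m"
    using dvd by (auto simp: order_def carF rel_index_def)
  then obtain A where A: "subgroup A (?Q Mod N)" "card A = p ^ i"
    using sylow_thm[OF p F.group_axioms] fin carF by metis
  \<comment> \<open>\<open>A\<close> is a set of cosets, so its union is its preimage in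
    \<open>Q\<close>.\<close>
  have U: "\<Union>A = {x \<in> Q. N #> x \<in> A}"
    using NQ.factgroup_subgroup_union_char[OF A(1)] by (simp add: coset)
  have sub: "subgroup (\<Union>A) G"
    using NQ.factgroup_subgroup_union_subgroup[OF A(1)] incl_subgroup[OF Q] by blast
  have "N \<in> A" using subgroup.one_closed[OF A(1)] by simp
  then have NU: "N \<subseteq> \<Union>A" by blast
  have AF: "A \<subseteq> r_coset G N ` Q" using subgroup.subset[OF A(1)] carF by simp
  then have im: "r_coset G N ` (\<Union>A) = A" unfolding U by auto
  show thesis
  proof (rule that[OF sub NU])
    show "\<Union>A \<subseteq> Q" unfolding U by auto
    show "rel_index G (\<Union>A) N = p ^ i" unfolding rel_index_def im by (rule A(2))
    assume "i = 1"
    then have "card A = p" using A by simp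
    from F.subgroup_prime_order_cyclic[OF A(1) this p] obtain x where
      x: "x \<in> A" "F.ord x = p" "\<And>y. y \<in> A \<Longrightarrow> \<exists>j::int. y = x [^]\<^bsub>?Q Mod N\<^esub> j" by blast
    obtain c where c: "c \<in> Q" "x = N #> c" using x AF by blast
    have cc: "c \<in> carrier G" using c Qc by blast
    have pow: "x [^]\<^bsub>?Q Mod N\<^esub> j = N #> c [^] j" for j :: int
      using NQ.FactGroup_int_pow[of c j] c int_pow_consistent[OF Q c(1), of j] by (simp add: coset)
    have "\<exists>j::int. y \<otimes> inv (c [^] j) \<in> N" if y: "y \<in> \<Union>A" for y
    proof -
      have "N #> y \<in> A" "y \<in> carrier G" using y Qc unfolding U by auto
      then show ?thesis using x(3)[of "N #> y"] pow r_coset_eq_iff[OF N(1)] cc by auto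
    qed
    moreover have "c [^] j \<in> N \<longleftrightarrow> int p dvd j" for j :: int
    proof -
      have "c [^] j \<in> N \<longleftrightarrow> N #> c [^] j = N"
        using cc N(1) coset_join1 coset_join2 by (metis int_pow_closed)
      also have "\<dots> \<longleftrightarrow> x [^]\<^bsub>?Q Mod N\<^esub> j = \<one>\<^bsub>?Q Mod N\<^esub>" by (simp add: pow)
      also have "\<dots> \<longleftrightarrow> int p dvd j" using F.int_pow_eq_id[of x j] x AF carF by auto
      finally show ?thesis .
    qed
    moreover have "c \<in> \<Union>A" unfolding U using c x by simp
    ultimately show "\<exists>c\<in>\<Union>A. (\<forall>x\<in>\<Union>A. \<exists>j::int. x \<otimes> inv (c [^] j) \<in> N) \<and> (\<forall>j::int. c [^] j \<in> N \<longleftrightarrow> int p dvd j)"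
      by blast
  qed
qed

text \<open>By Sylow, \<open>Q / N\<close> contains a subgroup of order at least \<open>T\<close> that is cyclic or of bounded
  order. Its preimage in \<open>Q\<close> has few Schreier generators, and since the subgroup has a presentation
  with a bounded number of relators, only boundedly many further normal generators are needed.\<close>

lemma normal_generators_large_quotient:
  assumes S: "finite S" "S \<subseteq> carrier G" "generate G S = carrier G"
    and Q: "subgroup Q G" and N: "subgroup N G" "N \<subseteq> Q"
    and norm: "\<And>q n. q \<in> Q \<Longrightarrow> n \<in> N \<Longrightarrow> q \<otimes> n \<otimes> inv q \<in> N"
    and fin: "finite (r_coset G N ` carrier G)" and T: "T \<ge> 1" and big: "rel_index G Q N > T ^ T"
  obtains R where "finite R" "R \<subseteq> N" "conj_closure G Q R = N"
    "T * card R \<le> card S * rel_index G (carrier G) N + T * (T^4 + T^2 + 1)"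
proof -
  have Qc: "Q \<subseteq> carrier G" using Q by (rule subgroup.subset)
  have finQ: "finite (r_coset G N ` Q)" using fin Qc by (meson finite_subset image_mono)
  obtain p i where p: "Factorial_Ring.prime p" "p ^ i dvd rel_index G Q N" "p ^ i \<ge> T" "p ^ i \<le> T\<^sup>2 \<or> i = 1"
    using large_prime_power_divisor[OF T big] by blast
  obtain K where K: "subgroup K G" "N \<subseteq> K" "K \<subseteq> Q" "rel_index G K N = p ^ i"
    and cyc: "i = 1 \<Longrightarrow> \<exists>c\<in>K. (\<forall>x\<in>K. \<exists>j::int. x \<otimes> inv (c [^] j) \<in> N) \<and> (\<forall>j::int. c [^] j \<in> N \<longleftrightarrow> int p dvd j)"
    using prime_power_overgroup[OF Q N norm finQ p(1,2)] by blast
  have Kc: "K \<subseteq> carrier G" using K(1) by (rule subgroup.subset)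
  have finK: "finite (r_coset G N ` K)" using fin Kc by (meson finite_subset image_mono)
  have mult: "rel_index G (carrier G) N = rel_index G (carrier G) K * p ^ i"
    using rel_index_mult[OF N(1) K(1) subgroup_self K(2) Kc] K(4) by simp
  \<comment> \<open>Positivity passes to the factor \<open>rel_index G (carrier G) K\<close>, which
    yields the finiteness that Schreier's lemma requires.\<close>
  have "rel_index G (carrier G) N > 0"
    unfolding rel_index_def using fin by (simp add: card_gt_0_iff)  (metis empty_iff one_closed)
  then have "rel_index G (carrier G) K > 0" using mult by (metis mult_is_0 neq0_conv)
  then have "finite (r_coset G K ` generate G S)" unfolding rel_index_def S(3) by (rule card_ge_0_finite)
  then obtain S' where S': "finite S'" "S' \<subseteq> K" "generate G S' = K" "card S' \<le> card S * rel_index G (carrier G) K"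
    using schreier_generators[OF S(1,2) K(1)] S(3) Kc by metis
  have S'c: "S' \<subseteq> carrier G" using S' Kc by blast
  \<comment> \<open>A quotient of prime order costs one relator however large the prime is;
    otherwise its order is at most \<open>T^2\<close> and the multiplication table costs
    \<open>T^4 + T^2\<close>.\<close>
  obtain R where R: "finite R" "R \<subseteq> N" "conj_closure G Q R = N" "card R \<le> card S' + (T^4 + T^2 + 1)"
  proof (cases "i = 1")
    case True
    then obtain c where c: "c \<in> K" "\<And>x. x \<in> K \<Longrightarrow> \<exists>j::int. x \<otimes> inv (c [^] j) \<in> N"
      "\<And>j::int. c [^] j \<in> N \<longleftrightarrow> int p dvd j" using cyc by blast
    obtain R where "finite R" "R \<subseteq> N" "card R \<le> card S' + 1" "conj_closure G Q R = N"
      by (rule normal_generators_cyclic_quotient[OF Q S'(1) S'c S'(3)[symmetric] K(3) N(1) K(2) norm c])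
    then show thesis using that[of R] by simp
  next
    case False
    then have "rel_index G K N \<le> T\<^sup>2" using p K by simp
    then obtain R where "finite R" "R \<subseteq> N" "card R \<le> card S' + (T\<^sup>2)\<^sup>2 + T\<^sup>2" "conj_closure G Q R = N"
      using normal_generators_finite_quotient[OF Q S'(1) S'c S'(3)[symmetric] K(3) N(1) K(2) norm finK] by metis
    then show thesis using that[of R] by (simp flip: power_mult)
  qed
  \<comment> \<open>This is the gain: Schreier's count for \<open>K\<close> involves the index of
    \<open>K\<close>, smaller than that of \<open>N\<close> by the factor
    \<open>p ^ i \<ge> T\<close>.\<close>
  have "T * card S' \<le> p ^ i * (card S * rel_index G (carrier G) K)" using S'(4) p(3) by (intro mult_le_mono)
  then have "T * card S' \<le> card S * rel_index G (carrier G) N" by (simp add: mult ac_simps)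
  moreover have "T * card R \<le> T * (card S' + (T^4 + T^2 + 1))" using R(4) by (rule mult_left_mono) simp
  ultimately have "T * card R \<le> card S * rel_index G (carrier G) N + T * (T^4 + T^2 + 1)"
    by (simp only: add_mult_distrib2)
  then show thesis using that R by blast
qed

end

section \<open>Subgroups of a direct product\<close>

locale subgroup_of_product =
  A: group A + B: group B for A (structure) and B (structure) +
  fixes U
  assumes U: "subgroup U (A \<times>\<times> B)"
begin

abbreviation "P \<equiv> fst ` U"
abbreviation "Q \<equiv> snd ` U"
abbreviation "M \<equiv> {a \<in> carrier A. (a, \<one>\<^bsub>B\<^esub>) \<in> U}"
abbreviation "N \<equiv> {b \<in> carrier B. (\<one>\<^bsub>A\<^esub>, b) \<in> U}"

sublocale AB: group "A \<times>\<times> B"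
  by (rule DirProd_group) unfold_locales

sublocale fst_hom: group_hom "A \<times>\<times> B" A fst
  by unfold_locales (auto simp: hom_def)

sublocale snd_hom: group_hom "A \<times>\<times> B" B snd
  by unfold_locales (auto simp: hom_def)

lemma U_mult: "(a, b) \<in> U \<Longrightarrow> (c, d) \<in> U \<Longrightarrow> (a \<otimes>\<^bsub>A\<^esub> c, b \<otimes>\<^bsub>B\<^esub> d) \<in> U"
  using subgroup.m_closed[OF U] by fastforce

lemma U_carrier: "(a, b) \<in> U \<Longrightarrow> a \<in> carrier A" "(a, b) \<in> U \<Longrightarrow> b \<in> carrier B"
  using subgroup.subset[OF U] by auto

lemma U_inv: "(a, b) \<in> U \<Longrightarrow> (inv\<^bsub>A\<^esub> a, inv\<^bsub>B\<^esub> b) \<in> U"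
  using subgroup.m_inv_closed[OF U, of "(a, b)"] inv_DirProd[OF A.group_axioms B.group_axioms, of a b] U_carrier
  by auto

lemma U_one: "(\<one>\<^bsub>A\<^esub>, \<one>\<^bsub>B\<^esub>) \<in> U"
  using subgroup.one_closed[OF U] by simp

lemma subgroups: "subgroup P A" "subgroup Q B" "subgroup M A" "subgroup N B" "M \<subseteq> P" "N \<subseteq> Q"
proof -
  show "subgroup P A" using fst_hom.subgroup_img_is_subgroup[OF U] .
  show "subgroup Q B" using snd_hom.subgroup_img_is_subgroup[OF U] .
  show "subgroup M A"
    by (rule A.subgroupI) (use U_mult[of _ "\<one>\<^bsub>B\<^esub>" _ "\<one>\<^bsub>B\<^esub>"] U_inv[of _ "\<one>\<^bsub>B\<^esub>"] U_one in auto)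
  show "subgroup N B"
    by (rule B.subgroupI) (use U_mult[of "\<one>\<^bsub>A\<^esub>" _ "\<one>\<^bsub>A\<^esub>"] U_inv[of "\<one>\<^bsub>A\<^esub>"] U_one in auto)
  show "M \<subseteq> P" "N \<subseteq> Q" by force+
qed

text \<open>Lift \<open>q\<close> to some \<open>(p, q)\<close> in \<open>U\<close>; conjugating
  \<open>(\<one>, n)\<close> by it stays in \<open>U\<close> and keeps the first coordinate
  trivial.\<close>

lemma N_normal:
  assumes "q \<in> Q" "n \<in> N" shows "q \<otimes>\<^bsub>B\<^esub> n \<otimes>\<^bsub>B\<^esub> inv\<^bsub>B\<^esub> q \<in> N"
proof -
  obtain p where p: "(p, q) \<in> U" using assms by auto
  have "(p \<otimes>\<^bsub>A\<^esub> \<one>\<^bsub>A\<^esub> \<otimes>\<^bsub>A\<^esub> inv\<^bsub>A\<^esub> p, q \<otimes>\<^bsub>B\<^esub> n \<otimes>\<^bsub>B\<^esub> inv\<^bsub>B\<^esub> q) \<in> U"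
    using p assms by (auto intro!: U_mult U_inv)
  then show ?thesis using U_carrier[OF p] U_carrier(2) by auto
qed

text \<open>The generated subgroup projects onto \<open>P\<close> and \<open>Q\<close>. Its
  intersection with \<open>B\<close> contains \<open>R\<close> and is normalised by its projection,
  which contains \<open>Q\<close>, so it contains \<open>N\<close>. An element of \<open>U\<close>
  differs from a generated element with the same first coordinate only by an element of
  \<open>N\<close>.\<close>

lemma generate_lifts:
  assumes E: "E \<subseteq> U" "generate A (fst ` E) = P" and F: "F \<subseteq> U" "generate B (snd ` F) = Q"
    and R: "R \<subseteq> N" "conj_closure B Q R = N"
  shows "generate (A \<times>\<times> B) (E \<union> F \<union> Pair \<one>\<^bsub>A\<^esub> ` R) = U"
proof
  let ?W = "E \<union> F \<union> Pair \<one>\<^bsub>A\<^esub> ` R"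
  let ?V = "generate (A \<times>\<times> B) ?W"
  have WU: "?W \<subseteq> U" using E F R by auto
  show VU: "?V \<subseteq> U" using AB.generate_subgroup_incl[OF WU U] .
  have Wc: "?W \<subseteq> carrier (A \<times>\<times> B)" using WU subgroup.subset[OF U] by blast
  have V: "subgroup ?V (A \<times>\<times> B)" using AB.generate_is_subgroup[OF Wc] .
  interpret V: subgroup_of_product A B ?V
    by (intro subgroup_of_product.intro subgroup_of_product_axioms.intro A.group_axioms B.group_axioms V)
  have "fst ` E \<subseteq> fst ` ?V" "snd ` F \<subseteq> snd ` ?V" by (auto intro!: imageI generate.incl)
  then have PV: "P \<subseteq> fst ` ?V" and QV: "Q \<subseteq> snd ` ?V"
    unfolding E(2)[symmetric] F(2)[symmetric]
    using V.subgroups(1,2) by (simp_all only: A.generate_subgroup_incl B.generate_subgroup_incl)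
  have "R \<subseteq> {b \<in> carrier B. (\<one>\<^bsub>A\<^esub>, b) \<in> ?V}" using R(1) by (auto intro: generate.incl)
  then have NV: "N \<subseteq> {b \<in> carrier B. (\<one>\<^bsub>A\<^esub>, b) \<in> ?V}"
    unfolding R(2)[symmetric]
    by (intro B.conj_closure_least V.subgroups(4) V.N_normal) (use QV in auto)
  show "U \<subseteq> ?V"
  proof clarify
    fix a b assume ab: "(a, b) \<in> U"
    then have "a \<in> fst ` ?V" using PV by force
    then obtain c where c: "(a, c) \<in> ?V" by auto
    note car = U_carrier[OF ab] V.U_carrier(2)[OF c]
    have "(a \<otimes>\<^bsub>A\<^esub> inv\<^bsub>A\<^esub> a, b \<otimes>\<^bsub>B\<^esub> inv\<^bsub>B\<^esub> c) \<in> U" using ab c VU by (blast intro: U_mult U_inv)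
    then have "b \<otimes>\<^bsub>B\<^esub> inv\<^bsub>B\<^esub> c \<in> N" using car by simp
    then have "(\<one>\<^bsub>A\<^esub> \<otimes>\<^bsub>A\<^esub> a, b \<otimes>\<^bsub>B\<^esub> inv\<^bsub>B\<^esub> c \<otimes>\<^bsub>B\<^esub> c) \<in> ?V" using NV c by (blast intro: V.U_mult)
    then show "(a, b) \<in> ?V" using car by (simp add: B.m_assoc)
  qed
qed

end

section \<open>Index inequalities and Goursat's correspondence\<close>

locale finite_index_subgroup_of_product = subgroup_of_product +
  assumes fin: "finite (rcosets\<^bsub>A \<times>\<times> B\<^esub> U)"
begin

text \<open>The last hypothesis says that the pairs in \<open>S \<times> T\<close> lie in distinct
  cosets of \<open>U\<close>. The units make both sets nonempty, so finiteness of the product gives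
  finiteness of each factor.\<close>

lemma card_reps_le:
  assumes "S \<subseteq> carrier A" "T \<subseteq> carrier B" "\<one>\<^bsub>A\<^esub> \<in> S" "\<one>\<^bsub>B\<^esub> \<in> T"
    and inj: "\<And>s s' t t'. s \<in> S \<Longrightarrow> s' \<in> S \<Longrightarrow> t \<in> T \<Longrightarrow> t' \<in> T \<Longrightarrow>
      (s \<otimes>\<^bsub>A\<^esub> inv\<^bsub>A\<^esub> s', t \<otimes>\<^bsub>B\<^esub> inv\<^bsub>B\<^esub> t') \<in> U \<Longrightarrow> s = s' \<and> t = t'"
  shows "finite S" "finite T" "card S * card T \<le> grp_index (A \<times>\<times> B) U"
proof -
  have inj: "inj_on (r_coset (A \<times>\<times> B) U) (S \<times> T)"
  proof (rule inj_onI, clarify)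
    fix s t s' t' assume *: "s \<in> S" "t \<in> T" "s' \<in> S" "t' \<in> T"
      "U #>\<^bsub>A \<times>\<times> B\<^esub> (s, t) = U #>\<^bsub>A \<times>\<times> B\<^esub> (s', t')"
    have "(s \<otimes>\<^bsub>A\<^esub> inv\<^bsub>A\<^esub> s', t \<otimes>\<^bsub>B\<^esub> inv\<^bsub>B\<^esub> t') \<in> U"
      using * assms(1,2) AB.r_coset_eq_iff[OF U, of "(s,t)" "(s',t')"]
        inv_DirProd[OF A.group_axioms B.group_axioms, of s' t'] by auto
    then show "s = s' \<and> t = t'" using inj * by blast
  qed
  have sub: "r_coset (A \<times>\<times> B) U ` (S \<times> T) \<subseteq> rcosets\<^bsub>A \<times>\<times> B\<^esub> U"
    using assms(1,2) by (auto simp: RCOSETS_def)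
  have "finite (S \<times> T)" using finite_imageD[OF finite_subset[OF sub fin] inj] .
  then show "finite S" "finite T" using assms(3,4) by (auto simp: finite_cartesian_product_iff)
  show "card S * card T \<le> grp_index (A \<times>\<times> B) U"
    using card_inj_on_le[OF inj sub fin] by (simp add: grp_index_def card_cartesian_product)
qed

text \<open>Combine transversals of \<open>P\<close> in \<open>A\<close> and of \<open>N\<close> in
  \<open>B\<close>. Projecting to \<open>P\<close> first equates the \<open>A\<close>-coordinates;
  the quotient of the \<open>B\<close>-coordinates is then paired with \<open>\<one>\<close>, so it
  lies in \<open>N\<close>.\<close>

lemma index_bound_fst:
  shows "finite (r_coset A P ` carrier A)" "finite (r_coset B N ` carrier B)"
    "rel_index A (carrier A) P * rel_index B (carrier B) N \<le> grp_index (A \<times>\<times> B) U"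
proof -
  note sg = subgroups
  obtain S where S: "coset_reps A (carrier A) P S" "\<one>\<^bsub>A\<^esub> \<in> S"
    using A.coset_reps_exists[OF sg(1) A.subgroup_self subgroup.subset[OF sg(1)]] by blast
  obtain T where T: "coset_reps B (carrier B) N T" "\<one>\<^bsub>B\<^esub> \<in> T"
    using B.coset_reps_exists[OF sg(4) B.subgroup_self subgroup.subset[OF sg(4)]] by blast
  have c: "S \<subseteq> carrier A" "T \<subseteq> carrier B" using S T by (auto simp: coset_reps_def)
  have "s = s' \<and> t = t'" if *: "s \<in> S" "s' \<in> S" "t \<in> T" "t' \<in> T"
    "(s \<otimes>\<^bsub>A\<^esub> inv\<^bsub>A\<^esub> s', t \<otimes>\<^bsub>B\<^esub> inv\<^bsub>B\<^esub> t') \<in> U" for s s' t t'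
  proof -
    have "s \<otimes>\<^bsub>A\<^esub> inv\<^bsub>A\<^esub> s' \<in> P" using *(5) by force
    then have "s = s'" using A.coset_reps_unique[OF S(1) sg(1)] * by blast
    moreover from this have "t \<otimes>\<^bsub>B\<^esub> inv\<^bsub>B\<^esub> t' \<in> N" using * c by auto
    then have "t = t'" using B.coset_reps_unique[OF T(1) sg(4)] * by blast
    ultimately show ?thesis by blast
  qed
  note le = card_reps_le[OF c S(2) T(2) this]
  show "finite (r_coset A P ` carrier A)" "finite (r_coset B N ` carrier B)"
    using le(1,2) coset_reps_finite[OF S(1)] coset_reps_finite[OF T(1)] by auto
  show "rel_index A (carrier A) P * rel_index B (carrier B) N \<le> grp_index (A \<times>\<times> B) U"
    using le(3) coset_reps_card[OF S(1)] coset_reps_card[OF T(1)] by simp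
qed

text \<open>The mirror image: the \<open>B\<close>-coordinates are equated first, by projection to
  \<open>Q\<close>.\<close>

lemma index_bound_snd:
  shows "finite (r_coset A M ` carrier A)" "finite (r_coset B Q ` carrier B)"
    "rel_index A (carrier A) M * rel_index B (carrier B) Q \<le> grp_index (A \<times>\<times> B) U"
proof -
  note sg = subgroups
  obtain S where S: "coset_reps A (carrier A) M S" "\<one>\<^bsub>A\<^esub> \<in> S"
    using A.coset_reps_exists[OF sg(3) A.subgroup_self subgroup.subset[OF sg(3)]] by blast
  obtain T where T: "coset_reps B (carrier B) Q T" "\<one>\<^bsub>B\<^esub> \<in> T"
    using B.coset_reps_exists[OF sg(2) B.subgroup_self subgroup.subset[OF sg(2)]] by blast
  have c: "S \<subseteq> carrier A" "T \<subseteq> carrier B" using S T by (auto simp: coset_reps_def)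
  have "s = s' \<and> t = t'" if *: "s \<in> S" "s' \<in> S" "t \<in> T" "t' \<in> T"
    "(s \<otimes>\<^bsub>A\<^esub> inv\<^bsub>A\<^esub> s', t \<otimes>\<^bsub>B\<^esub> inv\<^bsub>B\<^esub> t') \<in> U" for s s' t t'
  proof -
    have "t \<otimes>\<^bsub>B\<^esub> inv\<^bsub>B\<^esub> t' \<in> Q" using *(5) by force
    then have "t = t'" using B.coset_reps_unique[OF T(1) sg(2)] * by blast
    moreover from this have "s \<otimes>\<^bsub>A\<^esub> inv\<^bsub>A\<^esub> s' \<in> M" using * c by auto
    then have "s = s'" using A.coset_reps_unique[OF S(1) sg(3)] * by blast
    ultimately show ?thesis by blast
  qed
  note le = card_reps_le[OF c S(2) T(2) this]
  show "finite (r_coset A M ` carrier A)" "finite (r_coset B Q ` carrier B)"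
    using le(1,2) coset_reps_finite[OF S(1)] coset_reps_finite[OF T(1)] by auto
  show "rel_index A (carrier A) M * rel_index B (carrier B) Q \<le> grp_index (A \<times>\<times> B) U"
    using le(3) coset_reps_card[OF S(1)] coset_reps_card[OF T(1)] by simp
qed

text \<open>Half of Goursat's lemma: sending \<open>s\<close> to the coset of any partner
  \<open>f s\<close> in \<open>B\<close> embeds \<open>P / M\<close> into
  \<open>Q / N\<close>.\<close>

lemma goursat_index_le: "rel_index A P M \<le> rel_index B Q N"
proof -
  note sg = subgroups
  have Pc: "P \<subseteq> carrier A" using sg(1) by (rule subgroup.subset)
  have Qc: "Q \<subseteq> carrier B" using sg(2) by (rule subgroup.subset)
  have finQ: "finite (r_coset B N ` Q)"
    using index_bound_fst(2) Qc by (meson finite_subset image_mono)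
  obtain S where S: "coset_reps A P M S" using A.coset_reps_exists[OF sg(3,1,5)] by blast
  have SP: "S \<subseteq> P" using S by (simp add: coset_reps_def)
  then have "\<forall>s\<in>S. \<exists>b. (s, b) \<in> U" by force
  from bchoice[OF this] obtain f where f: "\<And>s. s \<in> S \<Longrightarrow> (s, f s) \<in> U" by blast
  have "inj_on (\<lambda>s. N #>\<^bsub>B\<^esub> f s) S"
  proof (rule inj_onI)
    fix s t assume *: "s \<in> S" "t \<in> S" "N #>\<^bsub>B\<^esub> f s = N #>\<^bsub>B\<^esub> f t"
    have c: "s \<in> carrier A" "t \<in> carrier A" "f s \<in> carrier B" "f t \<in> carrier B"
      using f * U_carrier by blast+
    have "f s \<otimes>\<^bsub>B\<^esub> inv\<^bsub>B\<^esub> f t \<in> N" using * B.r_coset_eq_iff[OF sg(4)] c by blast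
    \<comment> \<open>Dividing by \<open>(\<one>, f s \<otimes> inv (f t))\<close> clears the second
      coordinate and puts \<open>s \<otimes> inv t\<close> into \<open>M\<close>.\<close>
    then have "(inv\<^bsub>A\<^esub> \<one>\<^bsub>A\<^esub>, inv\<^bsub>B\<^esub> (f s \<otimes>\<^bsub>B\<^esub> inv\<^bsub>B\<^esub> f t)) \<in> U" using U_inv by blast
    moreover have "(s \<otimes>\<^bsub>A\<^esub> inv\<^bsub>A\<^esub> t, f s \<otimes>\<^bsub>B\<^esub> inv\<^bsub>B\<^esub> f t) \<in> U"
      using f * by (blast intro: U_mult U_inv)
    ultimately have "(s \<otimes>\<^bsub>A\<^esub> inv\<^bsub>A\<^esub> t \<otimes>\<^bsub>A\<^esub> inv\<^bsub>A\<^esub> \<one>\<^bsub>A\<^esub>,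
        (f s \<otimes>\<^bsub>B\<^esub> inv\<^bsub>B\<^esub> f t) \<otimes>\<^bsub>B\<^esub> inv\<^bsub>B\<^esub> (f s \<otimes>\<^bsub>B\<^esub> inv\<^bsub>B\<^esub> f t)) \<in> U"
      by (blast intro: U_mult)
    then have "s \<otimes>\<^bsub>A\<^esub> inv\<^bsub>A\<^esub> t \<in> M" using c by (simp del: B.inv_mult_group)
    then show "s = t" using A.coset_reps_unique[OF S sg(3) Pc] * by blast
  qed
  moreover have "(\<lambda>s. N #>\<^bsub>B\<^esub> f s) ` S \<subseteq> r_coset B N ` Q" using f by force
  ultimately have "card S \<le> card (r_coset B N ` Q)" using finQ by (rule card_inj_on_le)
  then show ?thesis using coset_reps_card[OF S] by (simp add: rel_index_def)
qed


end

section \<open>Counting generators of \<open>U\<close>\<close>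

lemma rel_index_pos:
  assumes "finite (r_coset G H ` K)" "K \<noteq> {}"
  shows "rel_index G K H > 0"
  using assms by (simp add: rel_index_def card_gt_0_iff)

lemma (in group) min_gens_subgroup_le:
  assumes "subgroup H G" "finite S" "S \<subseteq> H" "generate G S = H"
  shows "min_gens (G\<lparr>carrier := H\<rparr>) \<le> card S"
  unfolding min_gens_def
  by (rule Least_le) (use assms generate_consistent[OF assms(3,1)] in auto)

context finite_index_subgroup_of_product
begin

lemma min_gens_le:
  assumes SA: "finite SA" "SA \<subseteq> carrier A" "generate A SA = carrier A"
    and SB: "finite SB" "SB \<subseteq> carrier B" "generate B SB = carrier B"
    and R: "finite R" "R \<subseteq> N" "conj_closure B Q R = N"
  shows "min_gens ((A \<times>\<times> B)\<lparr>carrier := U\<rparr>)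
    \<le> card SA * rel_index A (carrier A) P + card SB * rel_index B (carrier B) Q + card R"
proof -
  note sg = subgroups
  obtain E0 where E0: "finite E0" "E0 \<subseteq> P" "generate A E0 = P" "card E0 \<le> card SA * rel_index A (carrier A) P"
    using A.schreier_generators[OF SA(1,2) sg(1)] SA(3) subgroup.subset[OF sg(1)] index_bound_fst(1) by metis
  obtain F0 where F0: "finite F0" "F0 \<subseteq> Q" "generate B F0 = Q" "card F0 \<le> card SB * rel_index B (carrier B) Q"
    using B.schreier_generators[OF SB(1,2) sg(2)] SB(3) subgroup.subset[OF sg(2)] index_bound_snd(2) by metis
  \<comment> \<open>One preimage in \<open>U\<close> is picked for each generator, so lifting does
    not raise the count.\<close>
  obtain E where E: "E \<subseteq> U" "finite E" "fst ` E = E0" "card E \<le> card E0"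
    using E0(1,2) by (metis subset_image_inj card_image finite_image_iff order_refl)
  obtain F where F: "F \<subseteq> U" "finite F" "snd ` F = F0" "card F \<le> card F0"
    using F0(1,2) by (metis subset_image_inj card_image finite_image_iff order_refl)
  let ?W = "E \<union> F \<union> Pair \<one>\<^bsub>A\<^esub> ` R"
  have W: "finite ?W" "?W \<subseteq> U" using E F R by auto
  have "generate (A \<times>\<times> B) ?W = U" by (rule generate_lifts) (use E F E0 F0 R in auto)
  then have "min_gens ((A \<times>\<times> B)\<lparr>carrier := U\<rparr>) \<le> card ?W"
    by (rule AB.min_gens_subgroup_le[OF U W])
  also have "\<dots> \<le> card (E \<union> F) + card (Pair \<one>\<^bsub>A\<^esub> ` R)" by (rule card_Un_le)
  also have "\<dots> \<le> card E + card F + card R"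
    using card_image_le[OF R(1)] by (intro add_mono card_Un_le) auto
  finally show ?thesis using E0(4) F0(4) E(4) F(4) by linarith
qed

text \<open>The choice of \<open>R\<close> for small \<open>[Q : N]\<close>: a generating set of
  \<open>N\<close> also generates it as a normal subgroup.\<close>

lemma normal_generators_schreier:
  assumes SB: "finite SB" "SB \<subseteq> carrier B" "generate B SB = carrier B"
  obtains R where "finite R" "R \<subseteq> N" "conj_closure B Q R = N" "card R \<le> card SB * rel_index B (carrier B) N"
proof -
  note sg = subgroups
  have Nc: "N \<subseteq> carrier B" using sg(4) by (rule subgroup.subset)
  have Qc: "Q \<subseteq> carrier B" using sg(2) by (rule subgroup.subset)
  obtain R where R: "finite R" "R \<subseteq> N" "generate B R = N" "card R \<le> card SB * rel_index B (carrier B) N"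
    by (rule B.schreier_generators[OF SB(1,2) sg(4), unfolded SB(3), OF Nc index_bound_fst(2)])
  have Rc: "R \<subseteq> carrier B" using R Nc by blast
  have "conj_closure B Q R \<subseteq> N"
    by (rule B.conj_closure_least[OF sg(4) R(2)]) (rule N_normal)
  moreover have "generate B R \<subseteq> conj_closure B Q R"
    by (intro B.generate_subgroup_incl B.conj_closure_contains B.conj_closure_subgroup sg(2) Rc Qc)
  ultimately have "conj_closure B Q R = N" unfolding R(3) by (rule subset_antisym)
  then show thesis using that[OF R(1,2) _ R(4)] by simp
qed

text \<open>The parameter \<open>T\<close> separates the scales: for fixed \<open>T\<close> the
  first and last terms vanish as \<beta> and \<alpha> grow, and the middle term is made small by the
  choice of \<open>T\<close>.\<close>

lemma generation_ratio_bound: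
  fixes T :: nat
  assumes SA: "finite SA" "SA \<subseteq> carrier A" "generate A SA = carrier A"
    and SB: "finite SB" "SB \<subseteq> carrier B" "generate B SB = carrier B" and T: "T \<ge> 1"
  defines "D \<equiv> real (grp_index (A \<times>\<times> B) U)"
    and "\<alpha> \<equiv> real (grp_index A M)" and "\<beta> \<equiv> real (grp_index B N)"
  shows "\<bar>real (min_gens ((A \<times>\<times> B)\<lparr>carrier := U\<rparr>)) - 1\<bar> / D
    \<le> real (card SA) / \<beta> + real (card SB) / real T + real (card SB + card SB * T ^ T + (T^4 + T^2 + 1) + 1) / \<alpha>"
proof -
  note sg = subgroups
  define d where "d = real (min_gens ((A \<times>\<times> B)\<lparr>carrier := U\<rparr>))"
  define a where "a = real (card SA)"
  define b where "b = real (card SB)"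
  define C where "C = real (T^4 + T^2 + 1)"
  define \<pi> where "\<pi> = real (rel_index A (carrier A) P)"
  define \<kappa> where "\<kappa> = real (rel_index B (carrier B) Q)"
  define k where "k = rel_index B Q N"
  have \<alpha>: "\<alpha> = real (rel_index A (carrier A) M)" and \<beta>: "\<beta> = real (rel_index B (carrier B) N)"
    unfolding \<alpha>_def \<beta>_def by (simp_all add: rel_index_carrier)
  have ne: "carrier A \<noteq> {}" "carrier B \<noteq> {}" by auto
  have pos: "\<pi> \<ge> 1" "\<kappa> \<ge> 1" "\<alpha> \<ge> 1" "\<beta> \<ge> 1"
    using rel_index_pos[OF index_bound_fst(1) ne(1)] rel_index_pos[OF index_bound_fst(2) ne(2)]
      rel_index_pos[OF index_bound_snd(1) ne(1)] rel_index_pos[OF index_bound_snd(2) ne(2)]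
    unfolding \<pi>_def \<kappa>_def \<alpha> \<beta> by simp_all
  have nonneg: "a \<ge> 0" "b \<ge> 0" "C \<ge> 0" by (simp_all add: a_def b_def C_def)
  have D1: "\<pi> * \<beta> \<le> D"
    using index_bound_fst(3) unfolding \<pi>_def \<beta> D_def by (simp flip: of_nat_mult)
  have D2: "\<alpha> * \<kappa> \<le> D"
    using index_bound_snd(3) unfolding \<kappa>_def \<alpha> D_def by (simp flip: of_nat_mult)
  have Dpos: "D > 0" using D1 pos by (smt (verit) mult_le_cancel_left1)
  have r1: "\<pi> / D \<le> 1 / \<beta>" using D1 pos Dpos by (simp add: field_simps)
  have r2: "\<kappa> / D \<le> 1 / \<alpha>" using D2 pos Dpos by (simp add: field_simps)
  have r3: "1 / D \<le> 1 / \<alpha>"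
  proof -
    have "1 / D \<le> \<kappa> / D" using pos Dpos by (simp add: divide_right_mono)
    then show ?thesis using r2 by linarith
  qed
  have \<beta>D: "\<beta> / D \<le> 1 / \<pi>" using D1 pos Dpos by (simp add: field_simps)
  \<comment> \<open>\<open>[A : M] = [A : P] [P : M]\<close> and \<open>[P : M] \<le> k\<close> by
    Goursat, so a small \<open>k\<close> makes \<open>[A : P]\<close> large.\<close>
  have "rel_index A (carrier A) M \<le> rel_index A (carrier A) P * k"
    using A.rel_index_mult[OF sg(3,1) A.subgroup_self sg(5) subgroup.subset[OF sg(1)]] goursat_index_le
    by (simp add: k_def)
  then have \<alpha>k: "\<alpha> \<le> \<pi> * real k" unfolding \<alpha> \<pi>_def by (simp flip: of_nat_mult)
  obtain R where R: "finite R" "R \<subseteq> N" "conj_closure B Q R = N"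
    and ratio: "real (card R) / D \<le> b / real T + (b * T ^ T + C) / \<alpha>"
  proof (cases "k \<le> T ^ T")
    case True
    obtain R where R: "finite R" "R \<subseteq> N" "conj_closure B Q R = N" "card R \<le> card SB * rel_index B (carrier B) N"
      by (rule normal_generators_schreier[OF SB])
    \<comment> \<open>Since \<open>\<pi> \<ge> \<alpha> / T ^ T\<close> and
      \<open>D \<ge> \<pi> * \<beta>\<close>, the crude count \<open>b * \<beta>\<close> is at most
      \<open>b * T ^ T / \<alpha>\<close> relative to \<open>D\<close>.\<close>
    have "\<alpha> \<le> \<pi> * real (T ^ T)"
      using \<alpha>k True pos by (smt (verit) mult_left_mono of_nat_le_iff)
    then have "1 / \<pi> \<le> real (T ^ T) / \<alpha>" using pos by (simp add: field_simps)
    then have "\<beta> / D \<le> real (T ^ T) / \<alpha>" using \<beta>D by linarith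
    then have "b * (\<beta> / D) \<le> b * (real (T ^ T) / \<alpha>)" using nonneg(2) by (rule mult_left_mono)
    moreover have "real (card R) \<le> b * \<beta>" using R(4) unfolding b_def \<beta> by (simp flip: of_nat_mult)
    then have "real (card R) / D \<le> b * \<beta> / D" using Dpos by (simp add: divide_right_mono)
    moreover have "b / real T \<ge> 0" "C / \<alpha> \<ge> 0" using nonneg pos by simp_all
    ultimately have "real (card R) / D \<le> b / real T + (b * T ^ T + C) / \<alpha>"
      by (simp add: add_divide_distrib)
    then show thesis by (rule that[OF R(1-3)])
  next
    case False
    then have big: "rel_index B Q N > T ^ T" by (simp add: k_def)
    obtain R where R: "finite R" "R \<subseteq> N" "conj_closure B Q R = N"
      "T * card R \<le> card SB * rel_index B (carrier B) N + T * (T^4 + T^2 + 1)"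
      by (rule B.normal_generators_large_quotient[OF SB sg(2,4,6) N_normal index_bound_fst(2) T big])
    \<comment> \<open>Here the saving is the factor \<open>T\<close>, combined with
      \<open>\<beta> / D \<le> 1\<close>; the additive constant is absorbed by
      \<open>1 / D \<le> 1 / \<alpha>\<close>.\<close>
    have "real T * real (card R) \<le> b * \<beta> + real T * C"
      using R(4) unfolding b_def \<beta> C_def by (simp only: of_nat_le_iff flip: of_nat_mult of_nat_add)
    then have "real (card R) \<le> b * \<beta> / real T + C" using T by (simp add: field_simps)
    then have "real (card R) / D \<le> (b * \<beta> / real T + C) / D" using Dpos by (simp add: divide_right_mono)
    also have "\<dots> = (b / real T) * (\<beta> / D) + C * (1 / D)" by (simp add: add_divide_distrib)
    also have "\<dots> \<le> (b / real T) * 1 + C * (1 / \<alpha>)"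
    proof (intro add_mono mult_left_mono r3)
      have "1 / \<pi> \<le> 1" using pos by simp
      then show "\<beta> / D \<le> 1" using \<beta>D by linarith
    qed (use nonneg in auto)
    also have "\<dots> \<le> b / real T + (b * T ^ T + C) / \<alpha>"
      using nonneg pos by (simp add: add_divide_distrib)
    finally show thesis by (rule that[OF R(1-3)])
  qed
  have "d \<le> a * \<pi> + b * \<kappa> + real (card R)"
    using min_gens_le[OF SA SB R] unfolding d_def a_def b_def \<pi>_def \<kappa>_def
    by (simp only: of_nat_le_iff flip: of_nat_mult of_nat_add)
  moreover have "d \<ge> 0" by (simp add: d_def)
  \<comment> \<open>The bound \<open>\<bar>d - 1\<bar> \<le> d + 1\<close> also covers the trivial
    group, where \<open>d = 0\<close>.\<close>
  ultimately have "\<bar>d - 1\<bar> \<le> a * \<pi> + b * \<kappa> + real (card R) + 1" by linarith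
  then have "\<bar>d - 1\<bar> / D \<le> (a * \<pi> + b * \<kappa> + real (card R) + 1) / D" using Dpos by (simp add: divide_right_mono)
  also have "\<dots> = a * (\<pi> / D) + b * (\<kappa> / D) + real (card R) / D + 1 / D" by (simp add: add_divide_distrib)
  also have "\<dots> \<le> a * (1 / \<beta>) + b * (1 / \<alpha>) + (b / real T + (b * T ^ T + C) / \<alpha>) + 1 / \<alpha>"
    by (intro add_mono mult_left_mono r1 r2 r3 ratio nonneg)
  also have "\<dots> = a / \<beta> + b / real T + (b + b * T ^ T + C + 1) / \<alpha>" by (simp add: add_divide_distrib)
  finally show ?thesis by (simp add: d_def a_def b_def C_def ac_simps)
qed

end

section \<open>Passage to the limit\<close>

theorem theorem1p1:
  fixes A :: "('a, 'c) monoid_scheme" and B :: "('b, 'd) monoid_scheme"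
    and U :: "nat \<Rightarrow> ('a \<times> 'b) set"
  assumes "group A" and "group B"
    and "fin_gen A" and "fin_gen B"
    and "\<And>n. fin_index_subgroup (U n) (A \<times>\<times> B)"
    and "filterlim (\<lambda>n. grp_index A {a \<in> carrier A. (a, \<one>\<^bsub>B\<^esub>) \<in> U n}) at_top sequentially"
    and "filterlim (\<lambda>n. grp_index B {b \<in> carrier B. (\<one>\<^bsub>A\<^esub>, b) \<in> U n}) at_top sequentially"
  shows "(\<lambda>n. (real (min_gens ((A \<times>\<times> B)\<lparr>carrier := U n\<rparr>)) - 1)
               / real (grp_index (A \<times>\<times> B) (U n))) \<longlonglongrightarrow> 0"
proof -
  define \<alpha> where "\<alpha> n = real (grp_index A {a \<in> carrier A. (a, \<one>\<^bsub>B\<^esub>) \<in> U n})" for n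
  define \<beta> where "\<beta> n = real (grp_index B {b \<in> carrier B. (\<one>\<^bsub>A\<^esub>, b) \<in> U n})" for n
  define f where "f n = (real (min_gens ((A \<times>\<times> B)\<lparr>carrier := U n\<rparr>)) - 1)
    / real (grp_index (A \<times>\<times> B) (U n))" for n
  have \<alpha>: "filterlim \<alpha> at_top sequentially" and \<beta>: "filterlim \<beta> at_top sequentially"
    unfolding \<alpha>_def \<beta>_def
    by (rule filterlim_compose[OF filterlim_real_sequentially assms(6)],
        rule filterlim_compose[OF filterlim_real_sequentially assms(7)])
  obtain SA where SA: "finite SA" "SA \<subseteq> carrier A" "generate A SA = carrier A"
    using assms(3) by (auto simp: fin_gen_def)
  obtain SB where SB: "finite SB" "SB \<subseteq> carrier B" "generate B SB = carrier B"
    using assms(4) by (auto simp: fin_gen_def)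
  have bound: "\<bar>f n\<bar> \<le> real (card SA) / \<beta> n + real (card SB) / real T
      + real (card SB + card SB * T ^ T + (T^4 + T^2 + 1) + 1) / \<alpha> n" if T: "T \<ge> 1" for T n :: nat
  proof -
    have fi: "subgroup (U n) (A \<times>\<times> B)" "finite (rcosets\<^bsub>A \<times>\<times> B\<^esub> (U n))"
      using assms(5) by (auto simp: fin_index_subgroup_def)
    interpret finite_index_subgroup_of_product A B "U n"
      by (intro finite_index_subgroup_of_product.intro subgroup_of_product.intro
          subgroup_of_product_axioms.intro finite_index_subgroup_of_product_axioms.intro assms(1,2) fi)
    show ?thesis unfolding f_def \<alpha>_def \<beta>_def abs_divide abs_of_nat by (rule generation_ratio_bound[OF SA SB T])
  qed
  have "f \<longlonglongrightarrow> 0"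
  proof (rule tendstoI)
    fix e :: real assume e: "e > 0"
    \<comment> \<open>\<open>T\<close> is fixed before \<open>n\<close> varies, so that the middle
      term is below \<open>e\<close>; the numerators of the other two terms are then constants, and
      these terms tend to 0.\<close>
    obtain T :: nat where T: "real (card SB) / e < real T" using reals_Archimedean2 by blast
    then have "0 < real T" using e by (smt (verit) divide_nonneg_pos of_nat_0_le_iff)
    then have T1: "T \<ge> 1" and Te: "real (card SB) / real T < e" using T e by (auto simp: field_simps)
    define c where "c = real (card SB + card SB * T ^ T + (T^4 + T^2 + 1) + 1)"
    have "(\<lambda>n. real (card SA) / \<beta> n + real (card SB) / real T + c / \<alpha> n)
        \<longlonglongrightarrow> 0 + real (card SB) / real T + 0"
      by (intro tendsto_add tendsto_const tendsto_divide_0[OF tendsto_const] filterlim_at_top_imp_at_infinity \<alpha> \<beta>)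
    then have "\<forall>\<^sub>F n in sequentially. real (card SA) / \<beta> n + real (card SB) / real T + c / \<alpha> n < e"
      using Te by (intro order_tendstoD(2)) auto
    then show "\<forall>\<^sub>F n in sequentially. dist (f n) 0 < e"
    proof eventually_elim
      case (elim n)
      have "\<bar>f n\<bar> < e" using bound[OF T1, of n, folded c_def] elim by (rule le_less_trans)
      then show ?case by simp
    qed
  qed
  then show ?thesis unfolding f_def .
qed

end
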